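(* Let $c,k$ be fixed positive integers with $c\le k$, and let $s=s(n)$ be an integer-valued function with $s(n)\ge c$ for all $n$. If $s(n)=\omega(n^{1/c^2})$ as $n\to\infty$, then $p(n,c,k,s(n))=1-o(1)$, i.e. $\lim_{n\to\infty}p(n,c,k,s(n))=1$.
   Context: $C_n^k$ denotes the $k$-th power of the cycle on $n$ vertices: its vertex set is $\{0,\ldots,n-1\}$, and distinct vertices $i,j$ are adjacent iff $(i-j) \bmod n\in\{-k,\ldots,-1,1,\ldots,k\}$ (residues modulo $n$), i.e. iff their distance along the cycle is at most $k$. Given a set $L(x)$ of colours for each vertex $x$ of a graph $G$, an $L$-colouring of $G$ is a map $f$ from $V(G)$ to the colours with $f(x)\in L(x)$ for all $x\in V(G)$ and $f(x)\ne f(y)$ for every edge $(x,y)\in E(G)$; $G$ is $L$-colourable if it has an $L$-colouring. Let $\mathcal{S}$ be a set of colours of size $s(n)$. For each vertex of $C_n^k$, independently, draw a subset of $\mathcal{S}$ of size $c$ uniformly at random among all $c$-element subsets of $\mathcal{S}$; this gives a random list assignment $L$. Then $p(n,c,k,s(n))$ is the probability that $C_n^k$ is $L$-colourable. The parameters $c,k$ are fixed and all asymptotics are as $n\to\infty$; $f=o(g)$ means $\lim_{n\to\infty} f/g=0$, and $f=\omega(g)$ means $g=o(f)$. *)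

theory Defs
  imports "HOL-Probability.Probability" "HOL-Library.Landau_Symbols"
begin

definition cycle_power_verts :: "nat \<Rightarrow> nat set" where
  "cycle_power_verts n = {0..<n}"

(* Adjacency as a symmetric irreflexive relation. The condition i \<noteq> j is not
   implied by the other one: for n \<le> k, a nonzero d can be 0 modulo n. *)
definition cycle_power_edges :: "nat \<Rightarrow> nat \<Rightarrow> (nat \<times> nat) set" where
  "cycle_power_edges n k =
     {(i, j). i \<in> cycle_power_verts n \<and> j \<in> cycle_power_verts n \<and> i \<noteq> j \<and>
        (int i - int j) mod int n \<in> (\<lambda>d. d mod int n) ` ({- int k..int k} - {0})}"

definition list_colouring ::
  "'v set \<Rightarrow> ('v \<times> 'v) set \<Rightarrow> ('v \<Rightarrow> 'a set) \<Rightarrow> ('v \<Rightarrow> 'a) \<Rightarrow> bool" where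
  "list_colouring V E L f \<longleftrightarrow>
     (\<forall>x\<in>V. f x \<in> L x) \<and> (\<forall>(x, y)\<in>E. f x \<noteq> f y)"

definition list_colourable ::
  "'v set \<Rightarrow> ('v \<times> 'v) set \<Rightarrow> ('v \<Rightarrow> 'a set) \<Rightarrow> bool" where
  "list_colourable V E L \<longleftrightarrow> (\<exists>f. list_colouring V E L f)"

(* Meaningful for finite S with card S \<ge> c, so that the uniform distribution on
   the c-element subsets of S exists. Outside V the lists are set to {}. *)
definition random_lists :: "'v set \<Rightarrow> nat \<Rightarrow> 'a set \<Rightarrow> ('v \<Rightarrow> 'a set) pmf" where
  "random_lists V c S = Pi_pmf V {} (\<lambda>_. pmf_of_set {A. A \<subseteq> S \<and> card A = c})"

(* p(n, c, k, s), taking the colour set S itself in place of its size s. *)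
definition colourable_prob :: "nat \<Rightarrow> nat \<Rightarrow> nat \<Rightarrow> 'a set \<Rightarrow> real" where
  "colourable_prob n c k S =
     measure_pmf.prob (random_lists (cycle_power_verts n) c S)
       {L. list_colourable (cycle_power_verts n) (cycle_power_edges n k) L}"

end

(* Call c |W| - |L(W)| the excess of a vertex set W, where L(W) is the union of its lists.
   Let H be a minimal vertex set that is not L-colourable. By Hall's theorem and c >= 1, the
   excess of H is at least c^2. Start with a single vertex of H (excess 0) and repeatedly add a
   vertex of H that is adjacent to, and shares a colour with, a vertex already chosen. Each step
   raises the excess by at least 1, and the process can only stop at H itself, since otherwise
   the chosen part and the rest of H could be coloured independently. So some ball of radius c^2
   contains a set W of excess at least c^2. In a graph of bounded degree there are O(n) such W,
   each having this excess with probability O(s^(|L(W)| - c |W|)) = O(s^(-c^2)), and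
   n / s^(c^2) tends to 0. *)
theory Submission
  imports Defs "HOL-Real_Asymp.Real_Asymp"
begin

section \<open>Hall's marriage theorem\<close>

text \<open>Submodularity of cardinality for the two unions on the right: since \<open>x\<close> and
  \<open>y\<close> differ, these together cover \<open>B\<close> again, and their intersection
  contains \<open>P \<inter> Q\<close>.\<close>

lemma card_Un_Diff_singletons:
  assumes "finite P" "finite Q" "finite B" "x \<noteq> y"
  shows "card (P \<union> Q \<union> B) + card (P \<inter> Q) \<le> card (P \<union> (B - {x})) + card (Q \<union> (B - {y}))"
proof -
  have "card (P \<union> (B - {x})) + card (Q \<union> (B - {y})) =
      card ((P \<union> (B - {x})) \<union> (Q \<union> (B - {y}))) + card ((P \<union> (B - {x})) \<inter> (Q \<union> (B - {y})))"
    using assms by (intro card_Un_Int) auto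
  moreover have "(P \<union> (B - {x})) \<union> (Q \<union> (B - {y})) = P \<union> Q \<union> B"
    using assms(4) by auto
  moreover have "card (P \<inter> Q) \<le> card ((P \<union> (B - {x})) \<inter> (Q \<union> (B - {y})))"
    using assms by (intro card_mono) auto
  ultimately show ?thesis by simp
qed

text \<open>
  Rado's proof: if some \<open>A i\<close> has two distinct elements, one of them can be deleted without
  violating the hypothesis, as two violations would contradict submodularity.
\<close>
theorem Hall:
  assumes "finite I" and "\<And>i. i \<in> I \<Longrightarrow> finite (A i)"
    and "\<And>J. J \<subseteq> I \<Longrightarrow> card J \<le> card (\<Union>(A ` J))"
  shows "\<exists>f. inj_on f I \<and> (\<forall>i\<in>I. f i \<in> A i)"
  using assms(2,3)
proof (induction "\<Sum>i\<in>I. card (A i)" arbitrary: A rule: less_induct)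
  case less
  have ne: "A i \<noteq> {}" if "i \<in> I" for i
    using less.prems(2)[of "{i}"] that by auto
  show ?case
  proof (cases "\<exists>i\<in>I. \<exists>x\<in>A i. \<exists>y\<in>A i. x \<noteq> y")
    case False
    define f where "f i = (SOME x. x \<in> A i)" for i
    have f: "f i \<in> A i" if "i \<in> I" for i
      unfolding f_def using ne[OF that] by (simp add: some_in_eq)
    have A: "A i = {f i}" if "i \<in> I" for i
      using f[OF that] that False by blast
    have "inj_on f I"
    proof
      fix i j assume ij: "i \<in> I" "j \<in> I" "f i = f j"
      have "card {i, j} \<le> card (\<Union>(A ` {i, j}))"
        using ij by (intro less.prems(2)) auto
      also have "\<Union>(A ` {i, j}) = {f i}"
        using ij A by auto
      finally show "i = j" by (cases "i = j") auto
    qed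
    with f show ?thesis by blast
  next
    case True
    then obtain i x y where i: "i \<in> I" and xy: "x \<in> A i" "y \<in> A i" "x \<noteq> y" by blast
    define B where "B z = A(i := A i - {z})" for z
    have fin: "finite (\<Union>(A ` J))" if "J \<subseteq> I" for J
      using that less.prems(1) assms(1) by (auto intro: finite_subset)
    have shrink: ?thesis if z: "z \<in> A i" and Hall: "\<And>J. J \<subseteq> I \<Longrightarrow> card J \<le> card (\<Union>(B z ` J))" for z
    proof -
      have "(\<Sum>j\<in>I. card (B z j)) < (\<Sum>j\<in>I. card (A j))"
      proof (rule sum_strict_mono_ex1)
        show "\<forall>j\<in>I. card (B z j) \<le> card (A j)"
          using less.prems(1) by (auto simp: B_def intro: card_mono)
        show "\<exists>j\<in>I. card (B z j) < card (A j)"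
          using i z less.prems(1)[OF i] by (intro bexI[of _ i]) (auto simp: B_def card_gt_0_iff intro!: diff_less)
      qed (use assms(1) in auto)
      moreover have "finite (B z j)" if "j \<in> I" for j
        using less.prems(1)[OF that] less.prems(1)[OF i] by (auto simp: B_def)
      ultimately obtain f where "inj_on f I" "\<forall>j\<in>I. f j \<in> B z j"
        using less.hyps[of "B z"] Hall by auto
      moreover have "B z j \<subseteq> A j" for j by (auto simp: B_def)
      ultimately show ?thesis by blast
    qed
    \<comment> \<open>Deleting \<open>z\<close> changes only \<open>A i\<close>, so a violating
      family contains \<open>i\<close>. Dropping \<open>i\<close> lowers its size by one, which
      turns the strict violation into a weak inequality over \<open>I - {i}\<close>.\<close>
    have viol: "\<exists>J \<subseteq> I - {i}. card (\<Union>(A ` J) \<union> (A i - {z})) \<le> card J"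
      if J: "J \<subseteq> I" "\<not> card J \<le> card (\<Union>(B z ` J))" for J z
    proof -
      have "i \<in> J"
      proof (rule ccontr)
        assume "i \<notin> J"
        then have "B z ` J = A ` J" by (auto simp: B_def)
        with J less.prems(2)[of J] show False by simp
      qed
      moreover have "\<Union>(B z ` J) = \<Union>(A ` (J - {i})) \<union> (A i - {z})"
        using \<open>i \<in> J\<close> by (auto simp: B_def split: if_splits)
      moreover have "card J = Suc (card (J - {i}))"
        using \<open>i \<in> J\<close> J(1) assms(1) by (metis card_Suc_Diff1 finite_subset)
      ultimately show ?thesis
        using J by (intro exI[of _ "J - {i}"]) auto
    qed
    show ?thesis
    proof (rule ccontr)
      assume no: "\<not> ?thesis"
      have Hall_fails: "\<exists>J\<subseteq>I. \<not> card J \<le> card (\<Union>(B z ` J))" if "z \<in> A i" for z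
        using shrink[OF that] no by metis
      obtain J where J: "J \<subseteq> I - {i}" "card (\<Union>(A ` J) \<union> (A i - {x})) \<le> card J"
        using Hall_fails[OF xy(1)] viol[of _ x] by metis
      obtain K where K: "K \<subseteq> I - {i}" "card (\<Union>(A ` K) \<union> (A i - {y})) \<le> card K"
        using Hall_fails[OF xy(2)] viol[of _ y] by metis
      have finJK: "finite J" "finite K"
        using J K assms(1) by (meson finite_subset finite_Diff)+
      \<comment> \<open>Hall's condition is applied to \<open>insert i (J \<union> K)\<close>, where
        \<open>i\<close> supplies an extra 1, and to \<open>J \<inter> K\<close>. Submodularity then
        forces \<open>card J + card K + 1 \<le> card J + card K\<close>.\<close>
      have "Suc (card (J \<union> K)) = card (insert i (J \<union> K))"
        using J(1) K(1) finJK by (subst card_insert_disjoint) auto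
      also have "\<dots> \<le> card (\<Union>(A ` insert i (J \<union> K)))"
        using J K i by (intro less.prems(2)) auto
      also have "\<Union>(A ` insert i (J \<union> K)) = \<Union>(A ` J) \<union> \<Union>(A ` K) \<union> A i"
        by auto
      finally have 1: "Suc (card (J \<union> K)) \<le> card (\<Union>(A ` J) \<union> \<Union>(A ` K) \<union> A i)" .
      have "card (J \<inter> K) \<le> card (\<Union>(A ` (J \<inter> K)))"
        using J by (intro less.prems(2)) auto
      also have "\<dots> \<le> card (\<Union>(A ` J) \<inter> \<Union>(A ` K))"
        using fin[of J] J by (intro card_mono) auto
      finally have 2: "card (J \<inter> K) \<le> card (\<Union>(A ` J) \<inter> \<Union>(A ` K))" .
      have "card (\<Union>(A ` J) \<union> \<Union>(A ` K) \<union> A i) + card (\<Union>(A ` J) \<inter> \<Union>(A ` K))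
          \<le> card (\<Union>(A ` J) \<union> (A i - {x})) + card (\<Union>(A ` K) \<union> (A i - {y}))"
        using J K xy fin[of J] fin[of K] less.prems(1)[OF i] by (intro card_Un_Diff_singletons) auto
      with 1 2 J(2) K(2) card_Un_Int[OF finJK] show False by linarith
    qed
  qed
qed

section \<open>Excess of non-colourable vertex sets\<close>

text \<open>A family J violating Hall's condition contains a vertex with its whole list of c
  colours, so J has at least c + 1 members but fewer colours than members. Its excess is therefore
  at least (c - 1)(c + 1) + 1 = c^2. Each further vertex brings at most c new colours, so passing
  from J to H cannot lower the excess.\<close>

lemma card_UN_add_square_le:
  assumes "finite H" and "\<And>x. x \<in> H \<Longrightarrow> finite (L x) \<and> card (L x) = c"
    and "c \<ge> 1" and "\<nexists>f. inj_on f H \<and> (\<forall>x\<in>H. f x \<in> L x)"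
  shows "card (\<Union>(L ` H)) + c\<^sup>2 \<le> c * card H"
proof -
  obtain J where J: "J \<subseteq> H" "card (\<Union>(L ` J)) < card J"
    using Hall[of H L] assms by (metis not_le)
  have finJ: "finite J" using J assms(1) finite_subset by blast
  have "J \<noteq> {}" using J(2) by auto
  then obtain x where x: "x \<in> J" by blast
  have "c = card (L x)" using x J assms(2) by auto
  also have "\<dots> \<le> card (\<Union>(L ` J))"
    using x J assms(2) finJ by (intro card_mono) auto
  finally have c: "c < card J" using J(2) by simp
  have "card (\<Union>(L ` H)) = card (\<Union>(L ` J) \<union> \<Union>(L ` (H - J)))"
    using J(1) by (intro arg_cong[where f = card]) auto
  also have "\<dots> \<le> card (\<Union>(L ` J)) + card (\<Union>(L ` (H - J)))"
    by (rule card_Un_le)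
  also have "card (\<Union>(L ` (H - J))) \<le> (\<Sum>x\<in>H - J. card (L x))"
    using assms(1) by (intro card_UN_le) auto
  also have "\<dots> = c * card (H - J)"
    using assms(2) by simp
  finally have 1: "card (\<Union>(L ` H)) < card J + c * card (H - J)"
    using J(2) by linarith
  \<comment> \<open>Naming the surplus \<open>d\<close> over c + 1 avoids subtraction; the claim
    reduces to \<open>d \<le> c * d\<close>.\<close>
  obtain d where d: "card J = c + 1 + d"
    using c less_imp_Suc_add by fastforce
  have H: "card H = card J + card (H - J)"
    using assms(1) J(1) finJ by (metis card_Diff_subset card_mono le_add_diff_inverse)
  have "d \<le> c * d" using assms(3) by simp
  with 1 show ?thesis unfolding H d power2_eq_square distrib_left by linarith
qed

text \<open>The two colourings can be pasted together: an edge from W to H joins disjoint lists, so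
  its ends never receive the same colour. Symmetry of \<open>E\<close> covers the edges from H to
  W.\<close>

lemma list_colourable_Un:
  assumes "sym E" and "\<And>x y. \<lbrakk>x \<in> W; y \<in> H; (x, y) \<in> E\<rbrakk> \<Longrightarrow> L x \<inter> L y = {}"
    and "list_colourable W (Restr E W) L" and "list_colourable H (Restr E H) L"
    and "W \<inter> H = {}"
  shows "list_colourable (W \<union> H) (Restr E (W \<union> H)) L"
proof -
  obtain f g where fg: "list_colouring W (Restr E W) L f" "list_colouring H (Restr E H) L g"
    using assms(3,4) by (auto simp: list_colourable_def)
  have "list_colouring (W \<union> H) (Restr E (W \<union> H)) L (\<lambda>x. if x \<in> W then f x else g x)"
    using fg assms(2,5) symD[OF assms(1)]
    unfolding list_colouring_def by (fastforce split: if_splits)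
  then show ?thesis by (auto simp: list_colourable_def)
qed

theorem non_colourable_obstruction:
  assumes "finite V" and "E \<subseteq> V \<times> V" and "irrefl E" and "sym E"
    and L: "\<And>x. x \<in> V \<Longrightarrow> finite (L x) \<and> card (L x) = c" and "c \<ge> 1"
    and "\<not> list_colourable V E L"
  obtains v W where "v \<in> V" and "W \<subseteq> V" and "W \<subseteq> ((E \<union> Id) ^^ c\<^sup>2) `` {v}"
    and "card (\<Union>(L ` W)) + c\<^sup>2 \<le> c * card W"
proof -
  define bad where "bad H \<longleftrightarrow> H \<subseteq> V \<and> \<not> list_colourable H (Restr E H) L" for H
  have "Restr E V = E" using assms(2) by auto
  then have "bad V" using assms(7) by (simp add: bad_def)
  then obtain H where H: "bad H" and min: "\<And>H'. bad H' \<Longrightarrow> card H \<le> card H'"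
    using ex_has_least_nat[of bad V card] by blast
  have HV: "H \<subseteq> V" and finH: "finite H"
    using H assms(1) finite_subset by (auto simp: bad_def)
  have colourable: "list_colourable W (Restr E W) L" if "W \<subset> H" for W
    using min[of W] psubset_card_mono[OF finH that] that HV unfolding bad_def by fastforce
  have "H \<noteq> {}"
    using H by (auto simp: bad_def list_colourable_def list_colouring_def)
  then obtain v where v: "v \<in> H" by blast
  \<comment> \<open>Edges join distinct vertices, so an injective choice from the lists would be a
    colouring of \<open>H\<close>.\<close>
  have "\<nexists>f. inj_on f H \<and> (\<forall>x\<in>H. f x \<in> L x)"
  proof
    assume "\<exists>f. inj_on f H \<and> (\<forall>x\<in>H. f x \<in> L x)"
    then obtain f where f: "inj_on f H" "\<forall>x\<in>H. f x \<in> L x" by blast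
    then have "list_colouring H (Restr E H) L f"
      using \<open>irrefl E\<close> by (auto simp: list_colouring_def irrefl_def inj_on_def)
    with H show False by (auto simp: bad_def list_colourable_def)
  qed
  then have final: "card (\<Union>(L ` H)) + c\<^sup>2 \<le> c * card H"
    using HV finH \<open>c \<ge> 1\<close> L by (intro card_UN_add_square_le) auto
  \<comment> \<open>After j growth steps the set lies within distance j of \<open>v\<close>;
    \<open>Id\<close> makes these balls nested. The cap at c^2 handles growth that stops early at
    \<open>H\<close>, whose excess is only known to be at least c^2.\<close>
  have "\<exists>W \<subseteq> H. v \<in> W \<and> W \<subseteq> ((E \<union> Id) ^^ j) `` {v} \<and> card (\<Union>(L ` W)) + min j (c\<^sup>2) \<le> c * card W" for j
  proof (induction j)
    case 0
    show ?case using v HV L by (intro exI[of _ "{v}"]) auto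
  next
    case (Suc j)
    then obtain W where W: "W \<subseteq> H" "v \<in> W" "W \<subseteq> ((E \<union> Id) ^^ j) `` {v}"
      "card (\<Union>(L ` W)) + min j (c\<^sup>2) \<le> c * card W" by blast
    have finW: "finite W" using W finH finite_subset by blast
    have mono: "((E \<union> Id) ^^ j) `` {v} \<subseteq> ((E \<union> Id) ^^ Suc j) `` {v}"
      by auto
    show ?case
    proof (cases "W = H")
      case True
      with W mono final show ?thesis
        by (intro exI[of _ W]) auto
    next
      case False
      \<comment> \<open>Otherwise \<open>W\<close> and \<open>H - W\<close>, both proper subsets of
        \<open>H\<close> (the latter because \<open>v\<close> lies in \<open>W\<close>), are
        colourable by minimality, and their colourings combine.\<close>
      have "\<exists>w\<in>W. \<exists>u\<in>H - W. (w, u) \<in> E \<and> L w \<inter> L u \<noteq> {}"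
      proof (rule ccontr)
        assume no: "\<not> ?thesis"
        have "list_colourable (W \<union> (H - W)) (Restr E (W \<union> (H - W))) L"
        proof (rule list_colourable_Un[OF \<open>sym E\<close>])
          show "list_colourable W (Restr E W) L"
            using False W(1) by (intro colourable) auto
          show "list_colourable (H - W) (Restr E (H - W)) L"
            using W(1,2) by (intro colourable) auto
        qed (use no in auto)
        moreover have "W \<union> (H - W) = H" using W(1) by auto
        ultimately show False using H by (simp add: bad_def)
      qed
      then obtain w u where u: "w \<in> W" "u \<in> H" "u \<notin> W" "(w, u) \<in> E" "L w \<inter> L u \<noteq> {}" by blast
      have finL: "finite (\<Union>(L ` W))" "finite (L u)" "card (L u) = c"
        using finW W(1) u HV L by auto
      \<comment> \<open>A shared colour means that \<open>u\<close> adds at most c - 1 new colours,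
        while \<open>c * card W\<close> grows by c.\<close>
      have "0 < card (\<Union>(L ` W) \<inter> L u)"
        using finL u by (subst card_gt_0_iff) auto
      then have "card (\<Union>(L ` insert u W)) < card (\<Union>(L ` W)) + c"
        using card_Un_Int[OF finL(1,2)] finL(3) by (simp add: Un_commute)
      moreover have "card (insert u W) = Suc (card W)"
        using finW u by simp
      ultimately have "card (\<Union>(L ` insert u W)) + min (Suc j) (c\<^sup>2) \<le> c * card (insert u W)"
        using W(4) by (simp add: algebra_simps)
      moreover have "insert u W \<subseteq> ((E \<union> Id) ^^ Suc j) `` {v}"
        using W(3) u(1,4) mono by auto
      ultimately show ?thesis
        using W(1,2) u(2) by (intro exI[of _ "insert u W"]) auto
    qed
  qed
  from this[of "c\<^sup>2"] show thesis
    using that v HV by (metis min.idem subset_iff)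
qed

section \<open>Ball sizes and probability estimates for random lists\<close>

lemma card_relpow_Image_le:
  fixes R :: "('a \<times> 'a) set"
  assumes "\<And>x. finite (R `` {x}) \<and> card (R `` {x}) \<le> d"
  shows "finite ((R ^^ j) `` {v}) \<and> card ((R ^^ j) `` {v}) \<le> d ^ j"
proof (induction j)
  case (Suc j)
  have eq: "(R ^^ Suc j) `` {v} = (\<Union>x\<in>(R ^^ j) `` {v}. R `` {x})"
    by auto
  have "card ((R ^^ Suc j) `` {v}) \<le> (\<Sum>x\<in>(R ^^ j) `` {v}. card (R `` {x}))"
    unfolding eq using Suc by (intro card_UN_le) auto
  also have "\<dots> \<le> of_nat (card ((R ^^ j) `` {v})) * d"
    using assms by (intro sum_bounded_above) auto
  also have "\<dots> \<le> d ^ Suc j"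
    using Suc by simp
  finally show ?case
    unfolding eq using Suc assms by auto
qed auto

lemma set_random_lists:
  assumes "finite V" and "finite S" and "c \<le> card S" and "L \<in> set_pmf (random_lists V c S)" and "x \<in> V"
  shows "L x \<subseteq> S \<and> finite (L x) \<and> card (L x) = c"
proof -
  have "{A. A \<subseteq> S \<and> card A = c} \<noteq> {}"
    using obtain_subset_with_card_n[OF assms(3)] by blast
  then have "L x \<in> {A. A \<subseteq> S \<and> card A = c}"
    using assms by (auto simp: random_lists_def set_Pi_pmf PiE_dflt_def)
  then show ?thesis
    using assms(2) finite_subset by auto
qed

text \<open>The probability is a quotient of binomial coefficients; the numerator is at most
  \<open>card Q ^ c\<close> (it is 0 if Q has fewer than c elements) and the denominator at least
  \<open>(card S / c) ^ c\<close>.\<close>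

lemma prob_random_subset_le:
  assumes "finite S" and "c \<ge> 1" and "c \<le> card S" and "Q \<subseteq> S"
  shows "measure_pmf.prob (pmf_of_set {A. A \<subseteq> S \<and> card A = c}) {A. A \<subseteq> Q} \<le> (c * card Q / card S) ^ c"
proof -
  have ne: "{A. A \<subseteq> S \<and> card A = c} \<noteq> {}"
    using obtain_subset_with_card_n[OF assms(3)] by blast
  have "{A. A \<subseteq> S \<and> card A = c} \<inter> {A. A \<subseteq> Q} = {A. A \<subseteq> Q \<and> card A = c}"
    using assms(4) by auto
  then have "measure_pmf.prob (pmf_of_set {A. A \<subseteq> S \<and> card A = c}) {A. A \<subseteq> Q} =
      real (card Q choose c) / real (card S choose c)"
    using assms ne finite_subset[OF assms(4)] by (simp add: measure_pmf_of_set n_subsets)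
  also have "\<dots> \<le> real (card Q) ^ c / (card S / c) ^ c"
  proof (rule frac_le)
    show "real (card Q choose c) \<le> real (card Q) ^ c"
    proof (cases "c \<le> card Q")
      case True
      then show ?thesis using binomial_le_pow[OF True] by (metis of_nat_le_iff of_nat_power)
    qed (simp add: binomial_eq_0)
    show "(card S / c) ^ c \<le> real (card S choose c)"
      using binomial_ge_n_over_k_pow_k[OF assms(3), where 'a = real] by simp
  qed (use assms in auto)
  also have "\<dots> = (c * card Q / card S) ^ c"
    by (simp add: field_simps)
  finally show ?thesis .
qed

text \<open>Union bound over the colour sets Q of size q = c |W| - c^2 that may contain all lists of
  W. There are at most |S|^q of them, and each works with probability at most (c q / |S|)^(c |W|),
  so the powers of |S| combine to |S|^(-c^2).\<close>

lemma prob_few_colours_le: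
  assumes "finite V" and "W \<subseteq> V" and "finite S" and "c \<ge> 1" and "c \<le> card S" and "c * card W \<le> card S"
  shows "measure_pmf.prob (random_lists V c S) {L. card (\<Union>(L ` W)) + c\<^sup>2 \<le> c * card W}
    \<le> (c\<^sup>2 * card W) ^ (c * card W) / card S ^ c\<^sup>2"
proof (cases "c\<^sup>2 \<le> c * card W")
  \<comment> \<open>The event is empty here; in the other case the truncated subtraction defining
    \<open>q\<close> is exact.\<close>
  case False
  then have "{L :: 'a \<Rightarrow> 'b set. card (\<Union>(L ` W)) + c\<^sup>2 \<le> c * card W} = {}" by auto
  then show ?thesis by simp
next
  case True
  define q where "q = c * card W - c\<^sup>2"
  define \<Q> where "\<Q> = {Q. Q \<subseteq> S \<and> card Q = q}"
  let ?P = "measure_pmf.prob (random_lists V c S)"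
  define B where "B Q x = (if x \<in> W then {A. A \<subseteq> Q} else UNIV)" for Q :: "'b set" and x :: 'a
  have q: "q \<le> card S" "q + c\<^sup>2 = c * card W" "q \<le> c * card W"
    using True assms(6) by (auto simp: q_def)
  have S0: "card S > 0" using assms by linarith
  have fin: "finite \<Q>" using assms(3) by (simp add: \<Q>_def)
  have "?P {L. card (\<Union>(L ` W)) + c\<^sup>2 \<le> c * card W}
      = ?P ({L. card (\<Union>(L ` W)) + c\<^sup>2 \<le> c * card W} \<inter> set_pmf (random_lists V c S))"
    by (simp add: measure_Int_set_pmf)
  also have "\<dots> \<le> ?P (\<Union>Q\<in>\<Q>. Pi V (B Q))"
  proof (rule measure_pmf.finite_measure_mono)
    show "{L. card (\<Union>(L ` W)) + c\<^sup>2 \<le> c * card W} \<inter> set_pmf (random_lists V c S) \<subseteq> (\<Union>Q\<in>\<Q>. Pi V (B Q))"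
    proof
      fix L assume L: "L \<in> {L. card (\<Union>(L ` W)) + c\<^sup>2 \<le> c * card W} \<inter> set_pmf (random_lists V c S)"
      then have "\<Union>(L ` W) \<subseteq> S"
        using set_random_lists[OF assms(1,3,5)] assms(2) by blast
      moreover have "card (\<Union>(L ` W)) \<le> q"
        using L q(2) by auto
      \<comment> \<open>The colours used on \<open>W\<close> are padded to exactly \<open>q\<close>
        colours, which is possible since \<open>q \<le> card S\<close>.\<close>
      ultimately obtain Q where "\<Union>(L ` W) \<subseteq> Q" "Q \<subseteq> S" "card Q = q"
        using exists_subset_between[of "\<Union>(L ` W)" q S] q(1) assms(3) by blast
      then show "L \<in> (\<Union>Q\<in>\<Q>. Pi V (B Q))"
        by (intro UN_I[of Q]) (auto simp: \<Q>_def B_def UN_subset_iff)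
    qed
  qed simp
  also have "\<dots> \<le> (\<Sum>Q\<in>\<Q>. ?P (Pi V (B Q)))"
    using fin by (intro measure_UNION_le) auto
  also have "\<dots> \<le> (\<Sum>Q\<in>\<Q>. ((c * q / card S) ^ c) ^ card W)"
  proof (rule sum_mono)
    fix Q assume Q: "Q \<in> \<Q>"
    let ?p = "measure_pmf.prob (pmf_of_set {A. A \<subseteq> S \<and> card A = c})"
    \<comment> \<open>By independence the probability is a product; vertices outside
      \<open>W\<close> are unconstrained and contribute factors 1.\<close>
    have "?P (Pi V (B Q)) = (\<Prod>x\<in>V. ?p (B Q x))"
      using assms(1) by (simp add: random_lists_def measure_Pi_pmf_Pi)
    also have "\<dots> = (\<Prod>x\<in>W. ?p {A. A \<subseteq> Q})"
      using assms(1,2) by (intro prod.mono_neutral_cong_right) (auto simp: B_def)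
    also have "\<dots> \<le> ((c * q / card S) ^ c) ^ card W"
      using prob_random_subset_le[OF assms(3,4,5), of Q] Q
      by (auto simp: \<Q>_def intro!: power_mono)
    finally show "?P (Pi V (B Q)) \<le> ((c * q / card S) ^ c) ^ card W" .
  qed
  also have "\<dots> = real (card S choose q) * (c * q / card S) ^ (c * card W)"
    using assms(3) by (simp add: \<Q>_def n_subsets power_mult)
  also have "\<dots> \<le> real (card S) ^ q * (c * q / card S) ^ (c * card W)"
    using binomial_le_pow[OF q(1)] by (intro mult_right_mono) (metis of_nat_le_iff of_nat_power, simp)
  also have "\<dots> = (c * q) ^ (c * card W) / card S ^ c\<^sup>2"
    using S0 by (simp add: power_divide q(2)[symmetric] power_add)
  also have "\<dots> \<le> (c\<^sup>2 * card W) ^ (c * card W) / card S ^ c\<^sup>2"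
  proof -
    have "c * q \<le> c\<^sup>2 * card W"
      using q(3) by (simp add: power2_eq_square)
    then have "(c * q) ^ (c * card W) \<le> (c\<^sup>2 * card W) ^ (c * card W)"
      by (intro power_mono) auto
    then show ?thesis by (intro divide_right_mono of_nat_mono) auto
  qed
  finally show ?thesis .
qed

text \<open>Union bound over the obstructions (v, W). Since D bounds the size of a ball of radius
  c^2, there are at most |V| 2^D such pairs, and the factor in front of |V| / |S|^(c^2) depends only
  on c and d.\<close>

theorem prob_not_colourable_le:
  fixes E :: "('v \<times> 'v) set" and S :: "'a set"
  assumes "finite V" and "E \<subseteq> V \<times> V" and "irrefl E" and "sym E"
    and deg: "\<And>x. card (E `` {x}) \<le> d"
    and "finite S" and "c \<ge> 1" and "c \<le> card S" and D: "D = (d + 1) ^ c\<^sup>2" "c * D \<le> card S"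
  shows "measure_pmf.prob (random_lists V c S) {L. \<not> list_colourable V E L}
    \<le> 2 ^ D * real (c\<^sup>2 * D) ^ (c * D) * (real (card V) / real (card S) ^ c\<^sup>2)"
proof -
  let ?P = "measure_pmf.prob (random_lists V c S)"
  define N where "N v = ((E \<union> Id) ^^ c\<^sup>2) `` {v}" for v
  have "finite (E `` {x})" for x
    using assms(1,2) by (auto intro: finite_subset)
  \<comment> \<open>Staying in place counts as a move, hence \<open>d + 1\<close>.\<close>
  then have "finite ((E \<union> Id) `` {x}) \<and> card ((E \<union> Id) `` {x}) \<le> d + 1" for x
    using card_insert_le_m1[of "d + 1" "E `` {x}" x] deg[of x] by (simp add: Un_Image)
  from card_relpow_Image_le[OF this] have N: "finite (N v)" "card (N v) \<le> D" for v
    by (auto simp: N_def D)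
  define I where "I = (SIGMA v:V. Pow (N v \<inter> V))"
  have finI: "finite I" using assms(1) by (auto simp: I_def)
  have D1: "D \<ge> 1" by (simp add: D)
  have "card I = (\<Sum>v\<in>V. card (Pow (N v \<inter> V)))"
    using assms(1) by (auto simp: I_def)
  also have "\<dots> \<le> (\<Sum>v\<in>V. 2 ^ D)"
  proof (rule sum_mono)
    fix v
    have "card (N v \<inter> V) \<le> D"
      using card_mono[OF N(1), of "N v \<inter> V" v] N(2)[of v] by simp
    then show "card (Pow (N v \<inter> V)) \<le> 2 ^ D"
      using N(1) by (simp add: card_Pow del: Pow_Int_eq)
  qed
  finally have cardI: "card I \<le> card V * 2 ^ D" by simp
  define K where "K = real ((c\<^sup>2 * D) ^ (c * D)) / card S ^ c\<^sup>2"
  have "?P {L. \<not> list_colourable V E L} = ?P ({L. \<not> list_colourable V E L} \<inter> set_pmf (random_lists V c S))"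
    by (simp add: measure_Int_set_pmf)
  also have "\<dots> \<le> ?P (\<Union>(v, W)\<in>I. {L. card (\<Union>(L ` W)) + c\<^sup>2 \<le> c * card W})"
  proof (rule measure_pmf.finite_measure_mono)
    show "{L. \<not> list_colourable V E L} \<inter> set_pmf (random_lists V c S)
        \<subseteq> (\<Union>(v, W)\<in>I. {L. card (\<Union>(L ` W)) + c\<^sup>2 \<le> c * card W})"
    proof
      fix L assume L: "L \<in> {L. \<not> list_colourable V E L} \<inter> set_pmf (random_lists V c S)"
      have "finite (L x) \<and> card (L x) = c" if "x \<in> V" for x
        using set_random_lists[OF assms(1,6,8) _ that] L by blast
      then obtain v W where "v \<in> V" "W \<subseteq> V" "W \<subseteq> N v" "card (\<Union>(L ` W)) + c\<^sup>2 \<le> c * card W"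
        using non_colourable_obstruction[OF assms(1-4) _ assms(7)] L unfolding N_def by blast
      then show "L \<in> (\<Union>(v, W)\<in>I. {L. card (\<Union>(L ` W)) + c\<^sup>2 \<le> c * card W})"
        by (auto simp: I_def)
    qed
  qed simp
  also have "\<dots> \<le> (\<Sum>(v, W)\<in>I. ?P {L. card (\<Union>(L ` W)) + c\<^sup>2 \<le> c * card W})"
    unfolding split_def using finI by (intro measure_UNION_le) auto
  also have "\<dots> \<le> (\<Sum>vW\<in>I. K)"
  proof (rule sum_mono, clarify)
    fix v W assume vW: "(v, W) \<in> I"
    have W: "card W \<le> D" "W \<subseteq> V"
      using vW card_mono[OF N(1), of W v] N(2)[of v] by (auto simp: I_def)
    have cW: "c * card W \<le> c * D" using W by simp
    \<comment> \<open>Replacing \<open>card W\<close> by \<open>D\<close> makes the bound the same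
      for all pairs; the exponent may grow because the base is at least 1.\<close>
    have "?P {L. card (\<Union>(L ` W)) + c\<^sup>2 \<le> c * card W} \<le> (c\<^sup>2 * card W) ^ (c * card W) / card S ^ c\<^sup>2"
      using W(2) order_trans[OF cW D(2)] assms by (intro prob_few_colours_le) auto
    also have "(c\<^sup>2 * card W) ^ (c * card W) \<le> (c\<^sup>2 * D) ^ (c * card W)"
      using W by (intro power_mono) auto
    also have "(c\<^sup>2 * D) ^ (c * card W) \<le> (c\<^sup>2 * D) ^ (c * D)"
      using W assms(7) D1 by (intro power_increasing cW) simp
    finally show "?P {L. card (\<Union>(L ` W)) + c\<^sup>2 \<le> c * card W} \<le> K"
      by (simp add: K_def divide_right_mono)
  qed
  also have "\<dots> \<le> real (card V * 2 ^ D) * K"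
    using cardI by (simp only: sum_constant, intro mult_right_mono) (simp_all only: of_nat_le_iff, simp add: K_def)
  also have "\<dots> = 2 ^ D * real (c\<^sup>2 * D) ^ (c * D) * (real (card V) / real (card S) ^ c\<^sup>2)"
    by (simp add: K_def)
  finally show ?thesis .
qed

section \<open>Cycle powers\<close>

lemma irrefl_cycle_power_edges: "irrefl (cycle_power_edges n k)"
  by (auto simp: irrefl_def cycle_power_edges_def)

lemma sym_cycle_power_edges: "sym (cycle_power_edges n k)"
proof (rule symI)
  fix i j assume ij: "(i, j) \<in> cycle_power_edges n k"
  then obtain d where d: "d \<in> {- int k..int k} - {0}" "(int i - int j) mod int n = d mod int n"
    unfolding cycle_power_edges_def by blast
  have "(int j - int i) mod int n = (- d) mod int n"
    using mod_minus_cong[OF d(2)] by simp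
  moreover have "- d \<in> {- int k..int k} - {0}"
    using d(1) by auto
  ultimately show "(j, i) \<in> cycle_power_edges n k"
    using ij by (auto simp: cycle_power_edges_def)
qed

text \<open>A neighbour is determined by its offset from i modulo n, as vertices are less than n,
  and there are 2k nonzero offsets. For small n these may coincide modulo n, hence only an upper
  bound.\<close>

lemma degree_cycle_power_le: "card (cycle_power_edges n k `` {i}) \<le> 2 * k"
proof -
  let ?D = "{- int k..int k} - {0}"
  have "inj_on (\<lambda>j. (int i - int j) mod int n) (cycle_power_edges n k `` {i})"
  proof (rule inj_onI)
    fix j j' assume jj': "j \<in> cycle_power_edges n k `` {i}" "j' \<in> cycle_power_edges n k `` {i}"
      "(int i - int j) mod int n = (int i - int j') mod int n"
    have "int j mod int n = int j' mod int n"
      using mod_diff_cong[OF refl[of "int i mod int n"] jj'(3)] by simp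
    then show "j = j'"
      using jj'(1,2) by (auto simp: cycle_power_edges_def cycle_power_verts_def)
  qed
  then have "card (cycle_power_edges n k `` {i}) \<le> card ((\<lambda>d. d mod int n) ` ?D)"
    by (rule card_inj_on_le) (auto simp: cycle_power_edges_def)
  also have "\<dots> \<le> card ?D"
    by (rule card_image_le) auto
  also have "\<dots> = 2 * k"
    by (simp add: card_Diff_subset)
  finally show ?thesis .
qed

section \<open>Passage to the limit\<close>

theorem theorem2p2:
  fixes c k :: nat and s :: "nat \<Rightarrow> nat" and S :: "nat \<Rightarrow> 'a set"
  assumes "c \<ge> 1" and "k \<ge> 1" and "c \<le> k"
    and "\<And>n. n \<ge> 1 \<Longrightarrow> s n \<ge> c"
    and "\<And>n. n \<ge> 1 \<Longrightarrow> finite (S n) \<and> card (S n) = s n"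
    and "(\<lambda>n. real (s n)) \<in> \<omega>(\<lambda>n. real n powr (1 / real c ^ 2))"
  shows "(\<lambda>n. colourable_prob n c k (S n)) \<longlonglongrightarrow> 1"
proof -
  \<comment> \<open>\<open>D\<close> and \<open>M\<close> are the ball bound and the constant factor
    of \<open>prob_not_colourable_le\<close> for degree bound 2k.\<close>
  define D where "D = (2 * k + 1) ^ c\<^sup>2"
  define e where "e = 1 / real c ^ 2"
  define M where "M = 2 ^ D * real (c\<^sup>2 * D) ^ (c * D)"
  have e0: "e > 0" using assms(1) by (simp add: e_def)
  have "(\<lambda>n. real n powr e) \<in> o(\<lambda>n. real (s n))"
    using assms(6) by (simp add: smallomega_iff_smallo e_def)
  then have "(\<lambda>n. real n powr e / real (s n)) \<longlonglongrightarrow> 0"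
    by (rule smalloD_tendsto)
  \<comment> \<open>Raising to the power c^2 turns the growth hypothesis into n / s(n)^(c^2) tending
    to 0.\<close>
  then have "(\<lambda>n. (real n powr e / real (s n)) ^ c\<^sup>2) \<longlonglongrightarrow> 0 ^ c\<^sup>2"
    by (rule tendsto_power)
  moreover have "(real n powr e / real (s n)) ^ c\<^sup>2 = real n / real (s n) ^ c\<^sup>2" for n
    using assms(1) by (cases "n = 0") (simp_all add: e_def power_divide powr_power)
  ultimately have "(\<lambda>n. real n / real (s n) ^ c\<^sup>2) \<longlonglongrightarrow> 0"
    using assms(1) by (simp add: power_0_left)
  then have lim: "(\<lambda>n. 1 - M * (real n / real (s n) ^ c\<^sup>2)) \<longlonglongrightarrow> 1 - M * 0"
    by (intro tendsto_intros)
  \<comment> \<open>The union bound asks for at least \<open>c * D\<close> colours; eventually s(n)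
    is at least n^e, which tends to infinity.\<close>
  have "filterlim (\<lambda>n. real n powr e) at_top at_top"
    using e0 by real_asymp
  then have "\<forall>\<^sub>F n in at_top. real n powr e \<ge> c * D"
    by (simp add: filterlim_at_top)
  moreover have "\<forall>\<^sub>F n in at_top. real (s n) \<ge> real n powr e"
    using smallomegaD[OF assms(6), of 1] by (simp add: e_def)
  ultimately have large: "\<forall>\<^sub>F n in at_top. s n \<ge> c * D \<and> n \<ge> 1"
    using eventually_ge_at_top[of 1]
    by eventually_elim (metis of_nat_le_iff order_trans)
  have lower: "\<forall>\<^sub>F n in at_top. 1 - M * (real n / real (s n) ^ c\<^sup>2) \<le> colourable_prob n c k (S n)"
    using large
  proof eventually_elim
    case (elim n)
    let ?V = "cycle_power_verts n" and ?E = "cycle_power_edges n k"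
    have S: "finite (S n)" "card (S n) = s n" "c \<le> card (S n)"
      using assms(4,5) elim by auto
    have "measure_pmf.prob (random_lists ?V c (S n)) {L. \<not> list_colourable ?V ?E L}
        \<le> 2 ^ D * real (c\<^sup>2 * D) ^ (c * D) * (real (card ?V) / real (card (S n)) ^ c\<^sup>2)"
      by (rule prob_not_colourable_le[where d = "2 * k"])
        (use S elim assms(1) irrefl_cycle_power_edges sym_cycle_power_edges degree_cycle_power_le in
          \<open>auto simp: D_def cycle_power_verts_def cycle_power_edges_def\<close>)
    also have "\<dots> = M * (real n / real (s n) ^ c\<^sup>2)"
      by (simp add: M_def S(2) cycle_power_verts_def)
    also have "{L. \<not> list_colourable ?V ?E L} = UNIV - {L :: nat \<Rightarrow> 'a set. list_colourable ?V ?E L}"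
      by auto
    finally show ?case
      using measure_pmf.prob_compl[of "{L. list_colourable ?V ?E L}" "random_lists ?V c (S n)"]
      by (simp add: colourable_prob_def)
  qed
  show ?thesis
  proof (rule tendsto_sandwich[OF lower _ _ tendsto_const])
    show "(\<lambda>n. 1 - M * (real n / real (s n) ^ c\<^sup>2)) \<longlonglongrightarrow> 1"
      using lim by simp
  qed (simp add: colourable_prob_def measure_pmf.prob_le_1)
qed

end
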